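(* For $n \ge 1$ let $a_n$ be the number of subsets $S$ of $\{1,2,\ldots,n\}$ such that (i) $S$ has at least $2$ elements, and (ii) the difference set $D(S)$ contains only odd numbers. Then $a_n = H_{n-1}$ for all $n \ge 1$.
   Context: For a finite set $S = \{s_1 < s_2 < \cdots < s_k\}$ of natural numbers with $k \ge 2$, the difference set is $D(S) = \{s_2-s_1, s_3-s_2, \ldots, s_k-s_{k-1}\}$. The Fibonacci sequence is defined by $F_0 = 0$, $F_1 = 1$, and $F_n = F_{n-1}+F_{n-2}$ for $n \ge 2$. The sequence $(H_n)_{n\ge 0}$ is obtained by applying the partial sum operator twice to the Fibonacci sequence, that is, $H_n = \sum_{i=0}^n (n+1-i)F_i$. *)

theory Defs
  imports Main "HOL-Number_Theory.Fib"
begin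

(* Differences of consecutive elements of a finite set; natural-number subtraction never
   truncates here because sorted_list_of_set is increasing.  The result is empty when
   S is infinite or has fewer than two elements. *)
definition diff_set :: "nat set \<Rightarrow> nat set" where
  "diff_set S = (let s = sorted_list_of_set S
     in {s ! Suc i - s ! i | i. Suc i < length s})"

definition partial_sums :: "(nat \<Rightarrow> nat) \<Rightarrow> nat \<Rightarrow> nat" where
  "partial_sums f n = (\<Sum>i=0..n. f i)"

definition H :: "nat \<Rightarrow> nat" where
  "H = partial_sums (partial_sums fib)"

lemma H_explicit: "H n = (\<Sum>i=0..n. (n + 1 - i) * fib i)"
proof (induction n)
  case 0
  show ?case by (simp add: H_def partial_sums_def)
next
  case (Suc n)
  have "(\<Sum>i=0..n. (Suc n + 1 - i) * fib i) = (\<Sum>i=0..n. (n + 1 - i) * fib i + fib i)"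
    by (intro sum.cong refl) (simp add: Suc_diff_le)
  with Suc show ?case
    by (simp add: H_def partial_sums_def sum.distrib)
qed

end

theory Submission
  imports Defs
begin

text \<open>
  Sort the sets by their maximum \<open>m\<close>, and write such a set as \<open>insert m T\<close> with \<open>T\<close> a set of
  positive numbers below \<open>m\<close>. The point is that the number of admissible \<open>T\<close>, with \<open>T = {}\<close>
  included, is the Fibonacci number \<open>fib (m + 1)\<close>. Indeed, take the maximum \<open>m + 2\<close>. If \<open>m + 1\<close>
  belongs to \<open>T\<close>, it is the maximum of \<open>T\<close>, and the last gap is 1, so that \<open>T\<close> is just a set with
  maximum \<open>m + 1\<close>. If it does not, then parity also keeps \<open>m\<close> out of \<open>T\<close>, and replacing the top
  element \<open>m + 2\<close> by \<open>m\<close> does not change the parity of the last gap. This is the Fibonacci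
  recurrence (\<open>odd_below_Suc_Suc\<close>), and it starts at \<open>m = 0\<close> and \<open>m = 1\<close>, where \<open>T = {}\<close> is the only
  choice.

  Dropping \<open>T = {}\<close> leaves \<open>fib (m + 1) - 1\<close> sets with at least two elements, and this is the
  partial sum \<open>fib 0 + ... + fib (m - 1)\<close>. Summing over all maxima \<open>m \<le> n\<close> performs the second
  partial summation and gives \<open>H (n - 1)\<close>.
\<close>

section \<open>Adding a new maximum\<close>

definition odd_gaps :: "nat set \<Rightarrow> bool" where
  "odd_gaps S \<longleftrightarrow> (\<forall>d \<in> diff_set S. odd d)"

lemma sorted_list_of_set_insert_top:
  fixes m :: "'a :: linorder"
  assumes "finite S" and "\<forall>x\<in>S. x < m"
  shows "sorted_list_of_set (insert m S) = sorted_list_of_set S @ [m]"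
proof -
  have "sorted_list_of_set (set (sorted_list_of_set S @ [m])) = sorted_list_of_set S @ [m]"
    using assms
    by (intro sorted_list_of_set.idem_if_sorted_distinct)
       (auto simp: sorted_append less_imp_le)
  with assms(1) show ?thesis by simp
qed

lemma diff_set_small: "card S \<le> 1 \<Longrightarrow> diff_set S = {}"
  by (auto simp: diff_set_def)

lemma diff_set_insert_top:
  assumes "finite S" and "S \<noteq> {}" and "\<forall>x\<in>S. x < m"
  shows "diff_set (insert m S) = insert (m - Max S) (diff_set S)"
proof -
  define s where "s = sorted_list_of_set S"
  have ne: "s \<noteq> []" using assms by (simp add: s_def)
  have last: "s ! (length s - 1) = Max S"
  proof (rule Max_eqI[symmetric])
    fix x assume "x \<in> S"
    then obtain i where "i < length s" "x = s ! i"
      using assms(1) by (metis in_set_conv_nth s_def set_sorted_list_of_set)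
    moreover have "sorted s" by (simp add: s_def)
    ultimately show "x \<le> s ! (length s - 1)" by (auto intro: sorted_nth_mono)
  next
    have "s ! (length s - 1) \<in> set s" using ne by (intro nth_mem) auto
    then show "s ! (length s - 1) \<in> S" using assms(1) by (simp add: s_def)
  qed (rule assms(1))
  have "diff_set (insert m S) = (\<lambda>i. (s @ [m]) ! Suc i - (s @ [m]) ! i) ` {i. Suc i < length (s @ [m])}"
    using sorted_list_of_set_insert_top[OF assms(1,3)]
    by (auto simp: diff_set_def s_def Let_def)
  also have "{i. Suc i < length (s @ [m])} = insert (length s - 1) {i. Suc i < length s}"
    using ne by (cases s) auto
  also have "(\<lambda>i. (s @ [m]) ! Suc i - (s @ [m]) ! i) ` \<dots>
      = insert (m - Max S) ((\<lambda>i. s ! Suc i - s ! i) ` {i. Suc i < length s})"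
    using ne last by (auto simp: nth_append intro!: image_cong)
  also have "(\<lambda>i. s ! Suc i - s ! i) ` {i. Suc i < length s} = diff_set S"
    by (auto simp: diff_set_def s_def Let_def)
  finally show ?thesis .
qed

lemma odd_gaps_insert_top:
  assumes "finite S" and "\<forall>x\<in>S. x < m"
  shows "odd_gaps (insert m S) \<longleftrightarrow> S = {} \<or> odd_gaps S \<and> odd (m - Max S)"
  using assms diff_set_insert_top[of S m] diff_set_small[of "{m}"]
  by (cases "S = {}") (auto simp: odd_gaps_def)

section \<open>Sets with a given maximum\<close>

text \<open>
  These are the sets \<open>T\<close> that a maximum \<open>m\<close> can be put on top of. Leaving \<open>m\<close> itself out of them
  makes the families for different \<open>m\<close> comparable: changing the top element is then the identity
  map.
\<close>

definition odd_below :: "nat \<Rightarrow> nat set set" where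
  "odd_below m = {T. T \<subseteq> {1..<m} \<and> odd_gaps (insert m T)}"

lemma odd_below_iff:
  "T \<in> odd_below m \<longleftrightarrow> T \<subseteq> {1..<m} \<and> (T = {} \<or> odd_gaps T \<and> odd (m - Max T))"
proof (cases "T \<subseteq> {1..<m}")
  case True
  then have "finite T" "\<forall>x\<in>T. x < m" by (auto intro: finite_subset)
  then show ?thesis using True odd_gaps_insert_top[of T m] by (simp add: odd_below_def)
qed (simp add: odd_below_def)

lemma finite_odd_below: "finite (odd_below m)"
  by (rule finite_subset[of _ "Pow {1..<m}"]) (auto simp: odd_below_def)

text \<open>
  The two parts are the sets that avoid \<open>m + 1\<close> and the sets that contain it. The former keep away
  from \<open>m\<close> as well, because a last gap of 2 would be even.
\<close>

lemma odd_below_Suc_Suc: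
  "odd_below (Suc (Suc m)) = odd_below m \<union> insert (Suc m) ` odd_below (Suc m)"
proof (intro subset_antisym subsetI)
  fix T assume T: "T \<in> odd_below (Suc (Suc m))"
  then have sub: "T \<subseteq> {1..<Suc (Suc m)}" and fin: "finite T"
    by (auto simp: odd_below_def intro: finite_subset)
  show "T \<in> odd_below m \<union> insert (Suc m) ` odd_below (Suc m)"
  proof (cases "Suc m \<in> T")
    case True
    define U where "U = T - {Suc m}"
    have T_eq: "T = insert (Suc m) U" using True by (auto simp: U_def)
    have "U \<subseteq> {1..<Suc m}"
    proof
      fix x assume "x \<in> U"
      with sub have "x \<in> {1..<Suc (Suc m)}" "x \<noteq> Suc m" by (auto simp: U_def)
      then show "x \<in> {1..<Suc m}" by auto
    qed
    moreover have "odd_gaps T" using T True by (auto simp: odd_below_iff)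
    ultimately have "U \<in> odd_below (Suc m)" by (simp add: odd_below_def T_eq)
    with T_eq show ?thesis by blast
  next
    case False
    show ?thesis
    proof (cases "T = {}")
      case True
      then show ?thesis by (simp add: odd_below_iff)
    next
      case ne: False
      have Max_in: "Max T \<in> T" using fin ne by simp
      then have "Max T \<in> {1..<Suc (Suc m)}" using sub by blast
      moreover have "Max T \<noteq> Suc m" using Max_in False by metis
      ultimately have "Max T \<le> m" by auto
      have odd: "odd_gaps T" "odd (Suc (Suc m) - Max T)"
        using T ne by (auto simp: odd_below_iff)
      moreover have "Suc (Suc m) - Max T = Suc (Suc (m - Max T))"
        using \<open>Max T \<le> m\<close> by simp
      ultimately have odd_m: "odd (m - Max T)" by simp
      then have "Max T < m" using \<open>Max T \<le> m\<close> by (cases "Max T = m") auto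
      moreover have "x \<le> Max T" if "x \<in> T" for x using fin that by simp
      ultimately have "T \<subseteq> {1..<m}" using sub by (fastforce intro: le_less_trans)
      with odd odd_m show ?thesis by (simp add: odd_below_iff)
    qed
  qed
next
  fix T assume "T \<in> odd_below m \<union> insert (Suc m) ` odd_below (Suc m)"
  then show "T \<in> odd_below (Suc (Suc m))"
  proof
    assume T: "T \<in> odd_below m"
    show ?thesis
    proof (cases "T = {}")
      case True
      then show ?thesis by (simp add: odd_below_iff)
    next
      case False
      have sub: "T \<subseteq> {1..<m}" using T by (simp add: odd_below_iff)
      then have "Max T \<in> {1..<m}"
        using Max_in[of T] False finite_subset[of T "{1..<m}"] by blast
      then have "Suc (Suc m) - Max T = Suc (Suc (m - Max T))" by (auto simp: Suc_diff_le)
      moreover have "T \<subseteq> {1..<Suc (Suc m)}" using sub by force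
      ultimately show ?thesis using T False by (simp add: odd_below_iff)
    qed
  next
    assume "T \<in> insert (Suc m) ` odd_below (Suc m)"
    then obtain U where T_eq: "T = insert (Suc m) U" and U: "U \<in> odd_below (Suc m)" by blast
    have sub: "U \<subseteq> {1..<Suc m}" using U by (simp add: odd_below_def)
    then have "Max T = Suc m"
      unfolding T_eq by (intro Max_eqI) (auto intro: finite_subset)
    moreover have "T \<subseteq> {1..<Suc (Suc m)}" using sub by (force simp: T_eq)
    moreover have "odd_gaps T" using U by (simp add: odd_below_def T_eq)
    ultimately show ?thesis by (simp add: odd_below_iff)
  qed
qed

lemma inj_on_insert_top: "inj_on (insert m) (odd_below m)"
proof (rule inj_onI)
  fix T U assume "T \<in> odd_below m" "U \<in> odd_below m" and eq: "insert m T = insert m U"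
  then have "m \<notin> T" "m \<notin> U" by (auto simp: odd_below_def)
  with eq show "T = U" by (simp add: insert_ident)
qed

lemma card_odd_below: "card (odd_below m) = fib (Suc m)"
proof (induction m rule: fib.induct)
  case 1
  have "odd_below 0 = {{}}" by (auto simp: odd_below_iff)
  then show ?case by simp
next
  case 2
  have "odd_below (Suc 0) = {{}}" by (auto simp: odd_below_iff)
  then show ?case by simp
next
  case (3 m)
  have "odd_below m \<inter> insert (Suc m) ` odd_below (Suc m) = {}"
    by (auto simp: odd_below_def)
  then have "card (odd_below (Suc (Suc m))) = card (odd_below m) + card (odd_below (Suc m))"
    by (simp add: odd_below_Suc_Suc card_Un_disjoint finite_odd_below
        card_image[OF inj_on_insert_top])
  with 3 show ?case by simp
qed

lemma fib_eq_partial_sums: "fib (Suc (Suc n)) = Suc (partial_sums fib n)"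
  by (induction n) (simp_all add: partial_sums_def)

section \<open>Summing over the maxima\<close>

lemma odd_gap_sets_Suc:
  "{S. S \<subseteq> {1..Suc n} \<and> card S \<ge> 2 \<and> odd_gaps S}
    = {S. S \<subseteq> {1..n} \<and> card S \<ge> 2 \<and> odd_gaps S}
      \<union> insert (Suc n) ` (odd_below (Suc n) - {{}})"
  (is "?A = ?B \<union> ?C")
proof (intro subset_antisym subsetI)
  fix S assume S: "S \<in> ?A"
  show "S \<in> ?B \<union> ?C"
  proof (cases "Suc n \<in> S")
    case True
    define T where "T = S - {Suc n}"
    have S_eq: "S = insert (Suc n) T" using True by (auto simp: T_def)
    have "T \<subseteq> {1..<Suc n}"
    proof
      fix x assume "x \<in> T"
      with S have "x \<in> {1..Suc n}" "x \<noteq> Suc n" by (auto simp: T_def)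
      then show "x \<in> {1..<Suc n}" by auto
    qed
    moreover have "T \<noteq> {}" using S by (auto simp: S_eq)
    ultimately have "T \<in> odd_below (Suc n) - {{}}"
      using S by (simp add: odd_below_def S_eq)
    with S_eq show ?thesis by blast
  next
    case False
    with S have "S \<subseteq> {1..n}" by (auto simp: atLeastAtMostSuc_conv)
    with S show ?thesis by simp
  qed
next
  fix S assume "S \<in> ?B \<union> ?C"
  then show "S \<in> ?A"
  proof
    assume "S \<in> ?B"
    then show ?thesis by (auto simp: atLeastAtMostSuc_conv)
  next
    assume "S \<in> ?C"
    then obtain T where S_eq: "S = insert (Suc n) T"
      and T: "T \<in> odd_below (Suc n)" "T \<noteq> {}" by blast
    have sub: "T \<subseteq> {1..<Suc n}" using T by (simp add: odd_below_def)
    then have "finite T" "Suc n \<notin> T" by (auto intro: finite_subset)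
    then have "card S = Suc (card T)" "card T > 0"
      using T(2) by (auto simp: S_eq card_gt_0_iff)
    moreover have "S \<subseteq> {1..Suc n}" using sub by (force simp: S_eq)
    ultimately show ?thesis using T by (simp add: odd_below_def S_eq)
  qed
qed

lemma card_odd_gap_sets_Suc:
  "card {S. S \<subseteq> {1..Suc n} \<and> card S \<ge> 2 \<and> odd_gaps S}
    = card {S. S \<subseteq> {1..n} \<and> card S \<ge> 2 \<and> odd_gaps S} + partial_sums fib n"
  (is "card ?A = card ?B + _")
proof -
  let ?C = "insert (Suc n) ` (odd_below (Suc n) - {{}})"
  have "{} \<in> odd_below (Suc n)" by (simp add: odd_below_iff)
  moreover have "inj_on (insert (Suc n)) (odd_below (Suc n) - {{}})"
    by (rule inj_on_subset[OF inj_on_insert_top]) auto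
  ultimately have "card ?C = fib (Suc (Suc n)) - 1"
    by (simp add: card_image card_Diff_singleton card_odd_below del: fib.simps)
  then have card_C: "card ?C = partial_sums fib n"
    by (simp add: fib_eq_partial_sums del: fib.simps)
  have "finite ?B" by (rule finite_subset[of _ "Pow {1..n}"]) auto
  moreover have "finite ?C" using finite_odd_below by simp
  moreover have "?B \<inter> ?C = {}" by auto
  ultimately have "card (?B \<union> ?C) = card ?B + card ?C" by (rule card_Un_disjoint)
  then show ?thesis by (simp only: odd_gap_sets_Suc card_C)
qed

lemma card_odd_gap_sets: "card {S. S \<subseteq> {1..Suc n} \<and> card S \<ge> 2 \<and> odd_gaps S} = H n"
proof (induction n)
  case 0
  have "{S :: nat set. S \<subseteq> {1..0} \<and> card S \<ge> 2 \<and> odd_gaps S} = {}" by auto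
  then show ?case
    using card_odd_gap_sets_Suc[of 0] by (simp add: H_def partial_sums_def)
next
  case (Suc n)
  have "H (Suc n) = H n + partial_sums fib (Suc n)"
    by (simp add: H_def partial_sums_def[of "partial_sums fib"])
  with Suc show ?case using card_odd_gap_sets_Suc[of "Suc n"] by simp
qed

theorem theorem1p6:
  fixes n :: nat
  assumes "n \<ge> 1"
  shows "card {S. S \<subseteq> {1..n} \<and> card S \<ge> 2 \<and> (\<forall>d \<in> diff_set S. odd d)} = H (n - 1)"
  using card_odd_gap_sets[of "n - 1"] assms by (simp add: odd_gaps_def)

end
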